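(* Let $p$ be a prime, let $1\le s\le p-1$, and let $n$ be a positive integer. Let $L\subseteq\mathbb{F}_p$ with $|L|=s$, and let $K\subseteq\mathbb{F}_p\setminus L$. Let $\mathcal{F}$ be a family of subsets of $[n]$ satisfying (i) $|F| \bmod p\in K$ for every $F\in\mathcal{F}$; (ii) $|E\cap F|\bmod p\in L$ for all distinct $E,F\in\mathcal{F}$. Then $$|\mathcal{F}|\le\sum_{j\in\operatorname{bsupp}(L)}\binom{n}{j}.$$
   Context: Here $[n]=\{1,\dots,n\}$. For $L\subseteq\mathbb{F}_p$ with $|L|=s<p$, the annihilator polynomial is $P_L(t)=\prod_{\ell\in L}(t-\ell)\in\mathbb{F}_p[t]$. For $0\le j\le s$, $\binom{t}{j}=\frac{1}{j!}t(t-1)\cdots(t-j+1)\in\mathbb{F}_p[t]$ denotes the binomial polynomial (well defined since $j\le s<p$); these polynomials form a basis of the space of polynomials of degree at most $s$ over $\mathbb{F}_p$. Write uniquely $P_L(t)=\sum_{j=0}^{s}c_j(L)\binom{t}{j}$ with $c_j(L)\in\mathbb{F}_p$. The binomial support of $P_L$ is $\operatorname{bsupp}(L)=\{j\in\{0,1,\dots,s\}:c_j(L)\ne 0\}$. *)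

theory Defs
  imports
    "HOL-Computational_Algebra.Polynomial"
    "Berlekamp_Zassenhaus.Finite_Field"
begin

text \<open>
  The field with \<open>p\<close> elements is the type \<open>'p mod_ring\<close>, where \<open>'p :: prime_card\<close> has
  \<open>p = CARD('p)\<close> elements; the residue of a natural number \<open>m\<close> is \<open>of_nat m\<close>.
\<close>

definition annihilator_poly :: "'p::prime_card mod_ring set \<Rightarrow> 'p mod_ring poly" where
  "annihilator_poly L = (\<Prod>l\<in>L. [:- l, 1:])"

text \<open>
  Since division by zero yields zero, the following is the binomial polynomial only for
  \<open>j < CARD('p)\<close>.
\<close>

definition binom_poly :: "nat \<Rightarrow> 'p::prime_card mod_ring poly" where
  "binom_poly j = smult (1 / of_nat (fact j)) (\<Prod>i<j. [:- of_nat i, 1:])"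

text \<open>
  The coefficients of the annihilator polynomial in the binomial basis, extended by zero beyond
  the degree so that they form a unique function on \<open>nat\<close>; existence and uniqueness
  for \<open>card L < CARD('p)\<close> is the lemma \<open>binom_coeff_ex1\<close> below.
\<close>

definition is_binom_expansion ::
    "'p::prime_card mod_ring set \<Rightarrow> (nat \<Rightarrow> 'p mod_ring) \<Rightarrow> bool" where
  "is_binom_expansion L c \<longleftrightarrow>
     (\<forall>j>card L. c j = 0) \<and> annihilator_poly L = (\<Sum>j\<le>card L. smult (c j) (binom_poly j))"

definition binom_coeff :: "'p::prime_card mod_ring set \<Rightarrow> nat \<Rightarrow> 'p mod_ring" where
  "binom_coeff L = (THE c. is_binom_expansion L c)"

definition bsupp :: "'p::prime_card mod_ring set \<Rightarrow> nat set" where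
  "bsupp L = {j \<in> {0..card L}. binom_coeff L j \<noteq> 0}"


lemma of_nat_fact_mod_ring_nonzero:
  assumes "j < CARD('p::prime_card)"
  shows "(of_nat (fact j) :: 'p mod_ring) \<noteq> 0"
proof
  assume "(of_nat (fact j) :: 'p mod_ring) = 0"
  then have "CARD('p) dvd fact j"
    by (rule of_nat_0_mod_ring_dvd)
  then show False
    using assms prime_dvd_fact_iff[OF prime_card[where 'a = 'p]] by simp
qed

lemma degree_prod_linear:
  fixes f :: "'b \<Rightarrow> 'a::field"
  shows "degree (\<Prod>i\<in>A. [:- f i, 1:]) = card A"
  by (subst degree_prod_eq_sum_degree) auto

lemma lead_coeff_prod_linear:
  fixes f :: "'b \<Rightarrow> 'a::field"
  shows "coeff (\<Prod>i\<in>A. [:- f i, 1:]) (card A) = 1"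
  using lead_coeff_prod[of "\<lambda>i. [:- f i, 1:]" A] by (simp add: degree_prod_linear)

lemma coeff_binom_poly_self:
  "coeff (binom_poly j :: 'p::prime_card mod_ring poly) j = 1 / of_nat (fact j)"
  using lead_coeff_prod_linear[of "of_nat :: nat \<Rightarrow> 'p mod_ring" "{..<j}"]
  by (simp add: binom_poly_def)

lemma coeff_binom_poly_above:
  assumes "j < i"
  shows "coeff (binom_poly j :: 'p::prime_card mod_ring poly) i = 0"
  using assms degree_prod_linear[of "of_nat :: nat \<Rightarrow> 'p mod_ring" "{..<j}"]
  by (simp add: binom_poly_def coeff_eq_0)

lemma binom_basis_ex1:
  fixes q :: "'p::prime_card mod_ring poly"
  assumes "m \<le> CARD('p)" and "\<forall>i\<ge>m. coeff q i = 0"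
  shows "\<exists>!c. (\<forall>j\<ge>m. c j = 0) \<and> q = (\<Sum>j<m. smult (c j) (binom_poly j))"
  using assms
proof (induction m arbitrary: q)
  case 0
  then have "q = 0"
    by (simp add: poly_eq_iff)
  then show ?case
    by (intro ex1I[of _ "\<lambda>_. 0"]) auto
next
  case (Suc m)
  let ?B = "binom_poly :: nat \<Rightarrow> 'p mod_ring poly"
  define a where "a = coeff q m * of_nat (fact m)"
  define r where "r = q - smult a (?B m)"
  have nz: "(of_nat (fact m) :: 'p mod_ring) \<noteq> 0"
    using Suc.prems(1) by (intro of_nat_fact_mod_ring_nonzero) simp
  have "coeff r i = 0" if "i \<ge> m" for i
  proof (cases "i = m")
    case True
    then show ?thesis
      using nz by (simp add: r_def a_def coeff_binom_poly_self)
  next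
    case False
    then show ?thesis
      using that Suc.prems(2) by (simp add: r_def coeff_binom_poly_above)
  qed
  then have "\<exists>!c. (\<forall>j\<ge>m. c j = 0) \<and> r = (\<Sum>j<m. smult (c j) (?B j))"
    using Suc.IH[of r] Suc.prems(1) by simp
  then obtain c where c: "\<forall>j\<ge>m. c j = 0" "r = (\<Sum>j<m. smult (c j) (?B j))"
    and uniq: "\<And>d. (\<forall>j\<ge>m. d j = 0) \<Longrightarrow> r = (\<Sum>j<m. smult (d j) (?B j)) \<Longrightarrow> d = c"
    by (elim ex1E) blast
  show ?case
  proof (intro ex1I[of _ "c(m := a)"] conjI)
    show "\<forall>j\<ge>Suc m. (c(m := a)) j = 0"
      using c(1) by simp
    have "(\<Sum>j<m. smult ((c(m := a)) j) (?B j)) = (\<Sum>j<m. smult (c j) (?B j))"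
      by (intro sum.cong) auto
    moreover have "q = r + smult a (?B m)"
      by (simp add: r_def)
    ultimately show "q = (\<Sum>j<Suc m. smult ((c(m := a)) j) (?B j))"
      using c(2) by simp
  next
    fix d
    assume d: "(\<forall>j\<ge>Suc m. d j = 0) \<and> q = (\<Sum>j<Suc m. smult (d j) (?B j))"
    have "coeff (\<Sum>j<m. smult (d j) (?B j)) m = 0"
      by (simp add: coeff_sum coeff_binom_poly_above)
    then have "coeff q m = d m / of_nat (fact m)"
      using d by (simp add: coeff_binom_poly_self)
    then have dm: "d m = a"
      using nz by (simp add: a_def)
    have "(\<Sum>j<m. smult ((d(m := 0)) j) (?B j)) = (\<Sum>j<m. smult (d j) (?B j))"
      by (intro sum.cong) auto
    then have "r = (\<Sum>j<m. smult ((d(m := 0)) j) (?B j))"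
      using d dm by (simp add: r_def)
    moreover have "\<forall>j\<ge>m. (d(m := 0)) j = 0"
      using d by auto
    ultimately have "d(m := 0) = c"
      by (intro uniq)
    then show "d = c(m := a)"
      using dm by auto
  qed
qed

lemma binom_coeff_ex1:
  fixes L :: "'p::prime_card mod_ring set"
  assumes "card L < CARD('p)"
  shows "\<exists>!c. is_binom_expansion L c"
proof -
  have "\<forall>i\<ge>Suc (card L). coeff (annihilator_poly L) i = 0"
    using degree_prod_linear[of "\<lambda>l. l" L] by (auto simp: annihilator_poly_def intro: coeff_eq_0)
  from binom_basis_ex1[OF _ this] assms show ?thesis
    by (simp add: is_binom_expansion_def Suc_le_eq lessThan_Suc_atMost)
qed

lemma is_binom_expansion_binom_coeff:
  fixes L :: "'p::prime_card mod_ring set"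
  assumes "card L < CARD('p)"
  shows "is_binom_expansion L (binom_coeff L)"
  unfolding binom_coeff_def using binom_coeff_ex1[OF assms] by (rule theI')

end

theory Submission
  imports Defs
begin

text \<open>
  Write the matrix with entries \<open>P\<^sub>L (|E \<inter> F|)\<close> for \<open>E, F \<in> \<F>\<close> in the binomial basis: since
  \<open>|E \<inter> F| choose j\<close> counts the \<open>j\<close>-sets contained in both \<open>E\<close> and \<open>F\<close>, the matrix factors
  through the space indexed by the subsets \<open>S\<close> of \<open>[n]\<close> with \<open>|S| \<in> bsupp L\<close>. By the
  hypotheses it is diagonal with nonzero diagonal, so its rank \<open>|\<F>|\<close> is at most the dimension
  of that space.
\<close>

text \<open>Both sides are the falling factorial of \<open>m\<close>. Keeping \<open>fact j\<close>
  on the right avoids division, so the identity holds in every commutative ring.\<close>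

lemma prod_of_nat_diff_eq_fact_binomial:
  "(\<Prod>i<j. of_nat m - of_nat i :: 'a::comm_ring_1) = of_nat (fact j * (m choose j))"
proof (induction j)
  case 0
  then show ?case by simp
next
  case (Suc j)
  show ?case
  proof (cases "j \<le> m")
    case True
    have "fact (Suc j) * (m choose Suc j) = fact j * (m choose j) * (m - j)"
      using binomial_absorb_comp[of m j] Suc_times_binomial_eq[of "m - 1" j]
      by (cases m) (simp_all add: algebra_simps)
    then show ?thesis
      using Suc True by (simp add: of_nat_diff)
  next
    case False
    \<comment> \<open>Here \<open>j > m\<close>, so the induction hypothesis says that the product
      is already zero.\<close>
    then show ?thesis
      using Suc by (simp add: binomial_eq_0)
  qed
qed

lemma poly_binom_poly_of_nat:
  assumes "j < CARD('p::prime_card)"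
  shows "poly (binom_poly j) (of_nat m :: 'p mod_ring) = of_nat (m choose j)"
proof -
  have "poly (binom_poly j) (of_nat m :: 'p mod_ring)
      = (\<Prod>i<j. of_nat m - of_nat i) / of_nat (fact j)"
    by (simp add: binom_poly_def poly_prod)
  also have "\<dots> = of_nat (m choose j)"
    unfolding prod_of_nat_diff_eq_fact_binomial
    using of_nat_fact_mod_ring_nonzero[OF assms] by simp
  finally show ?thesis .
qed

lemma poly_annihilator_poly:
  "finite L \<Longrightarrow> poly (annihilator_poly L) x = 0 \<longleftrightarrow> x \<in> L"
  by (auto simp: annihilator_poly_def poly_prod)

lemma finite_bsupp [simp]: "finite (bsupp L)"
  by (simp add: bsupp_def)

lemma sum_subsets_by_card:
  fixes f :: "nat \<Rightarrow> 'b::comm_semiring_1"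
  assumes "finite A" "finite J"
  shows "(\<Sum>S | S \<subseteq> A \<and> card S \<in> J. f (card S)) = (\<Sum>j\<in>J. of_nat (card A choose j) * f j)"
proof -
  have "(\<Sum>S | S \<subseteq> A \<and> card S \<in> J. f (card S))
      = (\<Sum>j\<in>J. \<Sum>S | S \<in> {S. S \<subseteq> A \<and> card S \<in> J} \<and> card S = j. f (card S))"
    using assms by (subst sum.group) auto
  also have "\<dots> = (\<Sum>j\<in>J. \<Sum>S | S \<subseteq> A \<and> card S = j. f j)"
    by (intro sum.cong) auto
  finally show ?thesis
    using assms by (simp add: n_subsets)
qed

text \<open>Each binomial in the expansion counts subsets of \<open>X\<close> of one size. With
  \<open>X = E \<inter> F\<close> the value becomes a sum over common subsets, which is what lets
  the matrix factor.\<close>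

lemma poly_annihilator_poly_card:
  fixes L :: "'p::prime_card mod_ring set"
  assumes "card L < CARD('p)" "finite X"
  shows "poly (annihilator_poly L) (of_nat (card X))
    = (\<Sum>S | S \<subseteq> X \<and> card S \<in> bsupp L. binom_coeff L (card S))"
proof -
  have "poly (annihilator_poly L) (of_nat (card X))
      = (\<Sum>j\<le>card L. binom_coeff L j * poly (binom_poly j) (of_nat (card X)))"
    using is_binom_expansion_binom_coeff[OF assms(1)]
    by (simp add: is_binom_expansion_def poly_sum)
  also have "\<dots> = (\<Sum>j\<le>card L. of_nat (card X choose j) * binom_coeff L j)"
    using assms(1) by (intro sum.cong) (auto simp: poly_binom_poly_of_nat mult.commute)
  also have "\<dots> = (\<Sum>j\<in>bsupp L. of_nat (card X choose j) * binom_coeff L j)"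
    by (intro sum.mono_neutral_right) (auto simp: bsupp_def)
  also have "\<dots> = (\<Sum>S | S \<subseteq> X \<and> card S \<in> bsupp L. binom_coeff L (card S))"
    using assms(2) by (simp add: sum_subsets_by_card)
  finally show ?thesis .
qed

text \<open>Pigeonhole over a finite field with q elements: q^|J| coefficient vectors have at most
  q^|I| images, so two collide, and their difference is a solution.\<close>

lemma homogeneous_system_nontrivial_solution:
  fixes v :: "'j \<Rightarrow> 'i \<Rightarrow> 'a::{finite,field}"
  assumes "finite I" "finite J" "card I < card J"
  obtains a where "\<exists>j\<in>J. a j \<noteq> 0" "\<And>i. i \<in> I \<Longrightarrow> (\<Sum>j\<in>J. a j * v j i) = 0"
proof -
  let ?A = "J \<rightarrow>\<^sub>E (UNIV :: 'a set)" and ?B = "I \<rightarrow>\<^sub>E (UNIV :: 'a set)"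
  define T where "T = (\<lambda>a. \<lambda>i\<in>I. \<Sum>j\<in>J. a j * v j i)"
  \<comment> \<open>A base of at least 2 makes powers strictly increasing in the exponent.\<close>
  have "card {0, 1 :: 'a} \<le> CARD('a)"
    by (intro card_mono) auto
  then have "card ?B < card ?A"
    using assms by (simp add: card_PiE power_strict_increasing_iff)
  moreover have "T ` ?A \<subseteq> ?B"
    by (auto simp: T_def)
  ultimately have "card (T ` ?A) < card ?A"
    using assms by (meson card_mono finite finite_PiE le_less_trans)
  then obtain b c where bc: "b \<in> ?A" "c \<in> ?A" "b \<noteq> c" "T b = T c"
    using pigeonhole unfolding inj_on_def by blast
  show thesis
  proof (rule that[of "\<lambda>j. b j - c j"])
    \<comment> \<open>Extensional functions that differ must differ inside \<open>J\<close>.\<close>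
    show "\<exists>j\<in>J. b j - c j \<noteq> 0"
      using bc PiE_ext[of b J _ c] by fastforce
    show "(\<Sum>j\<in>J. (b j - c j) * v j i) = 0" if "i \<in> I" for i
      using fun_cong[OF bc(4), of i] that by (simp add: T_def algebra_simps sum_subtractf)
  qed
qed

text \<open>If \<open>J\<close> were larger, the vectors \<open>v k\<close> would satisfy a
  nontrivial linear relation. Pairing it with \<open>u j\<close>, where \<open>a j\<close> is
  nonzero, leaves only \<open>a j\<close> times a nonzero diagonal entry.\<close>

lemma card_le_of_diagonal_factorization:
  fixes u v :: "'j \<Rightarrow> 'i \<Rightarrow> 'a::{finite,field}"
  assumes "finite I" "finite J"
    and diag: "\<And>j. j \<in> J \<Longrightarrow> (\<Sum>i\<in>I. u j i * v j i) \<noteq> 0"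
    and off: "\<And>j k. j \<in> J \<Longrightarrow> k \<in> J \<Longrightarrow> j \<noteq> k \<Longrightarrow> (\<Sum>i\<in>I. u j i * v k i) = 0"
  shows "card J \<le> card I"
proof (rule ccontr)
  assume "\<not> card J \<le> card I"
  then obtain a j where a: "\<And>i. i \<in> I \<Longrightarrow> (\<Sum>k\<in>J. a k * v k i) = 0" and j: "j \<in> J" "a j \<noteq> 0"
    using homogeneous_system_nontrivial_solution[OF assms(1,2)] by (metis not_le)
  have "0 = (\<Sum>i\<in>I. u j i * (\<Sum>k\<in>J. a k * v k i))"
    using a by simp
  also have "\<dots> = (\<Sum>k\<in>J. a k * (\<Sum>i\<in>I. u j i * v k i))"
    unfolding sum_distrib_left by (subst sum.swap) (simp add: mult_ac)
  also have "\<dots> = a j * (\<Sum>i\<in>I. u j i * v j i)"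
    using assms(2) j off[of j] by (subst sum.mono_neutral_right[of J "{j}"]) auto
  finally show False
    using diag j by simp
qed

theorem theorem6:
  fixes p s n :: nat
    and L K :: "'p::prime_card mod_ring set"
    and \<F> :: "nat set set"
  assumes "p = CARD('p)"
    and "1 \<le> s" and "s \<le> p - 1"
    and "n > 0"
    and "card L = s"
    and "K \<subseteq> - L"
    and "\<F> \<subseteq> Pow {1..n}"
    and "\<And>F. F \<in> \<F> \<Longrightarrow> of_nat (card F) \<in> K"
    and "\<And>E F. E \<in> \<F> \<Longrightarrow> F \<in> \<F> \<Longrightarrow> E \<noteq> F \<Longrightarrow> of_nat (card (E \<inter> F)) \<in> L"
  shows "card \<F> \<le> (\<Sum>j\<in>bsupp L. n choose j)"
proof -
  define I where "I = {S. S \<subseteq> {1..n} \<and> card S \<in> bsupp L}"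
  \<comment> \<open>The coefficient is put into \<open>u\<close> alone, so
    \<open>u E S * v F S\<close> is the coefficient at \<open>card S\<close> when
    \<open>S \<subseteq> E \<inter> F\<close>, and 0 otherwise.\<close>
  define u where "u E S = (if S \<subseteq> E then binom_coeff L (card S) else 0)" for E S :: "nat set"
  define v where "v F S = (if S \<subseteq> F then 1 else 0 :: 'p mod_ring)" for F S :: "nat set"
  have "card L < CARD('p)"
    using assms(1-3,5) by linarith
  have finite_I: "finite I"
    by (simp add: I_def)
  have matrix: "(\<Sum>S\<in>I. u E S * v F S) = poly (annihilator_poly L) (of_nat (card (E \<inter> F)))"
    if "E \<in> \<F>" for E F
  proof -
    have E: "E \<subseteq> {1..n}"
      using that assms(7) by auto
    then have "finite (E \<inter> F)"
      by (meson finite_Int finite_atLeastAtMost finite_subset)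
    moreover have "(\<Sum>S\<in>I. u E S * v F S)
        = (\<Sum>S | S \<subseteq> E \<inter> F \<and> card S \<in> bsupp L. binom_coeff L (card S))"
      \<comment> \<open>As \<open>E\<close> lies in [n], every subset of \<open>E \<inter> F\<close>
        with size in \<open>bsupp L\<close> belongs to \<open>I\<close>.\<close>
      using E finite_I by (intro sum.mono_neutral_cong_right) (auto simp: I_def u_def v_def)
    ultimately show ?thesis
      using \<open>card L < CARD('p)\<close> by (simp add: poly_annihilator_poly_card)
  qed
  have "card \<F> \<le> card I"
  proof (rule card_le_of_diagonal_factorization[where u = u and v = v])
    show "finite \<F>"
      using assms(7) by (rule finite_subset) simp
    \<comment> \<open>The entry is the annihilator polynomial at |F|, whose residue lies in
      \<open>K\<close> and hence is not a root.\<close>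
    show "(\<Sum>S\<in>I. u F S * v F S) \<noteq> 0" if "F \<in> \<F>" for F
      using that assms(6,8) by (auto simp: matrix poly_annihilator_poly)
    show "(\<Sum>S\<in>I. u E S * v F S) = 0" if "E \<in> \<F>" "F \<in> \<F>" "E \<noteq> F" for E F
      using that assms(9) by (simp add: matrix poly_annihilator_poly)
  qed (fact finite_I)
  also have "card I = (\<Sum>j\<in>bsupp L. n choose j)"
    using sum_subsets_by_card[of "{1..n}" "bsupp L" "\<lambda>_. 1 :: nat"] by (simp add: I_def)
  finally show ?thesis .
qed

end
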